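(* Let $k_0\ge0$ be a fixed integer. The reduction algorithm (defined in the context), applied to the Vietoris-Rips complex based on a binomial point process of $n$ points on the torus $\mathbb{T}^d_a$ in the subcritical regime $\theta=o(1/n)$, has asymptotically almost surely (as $n\to\infty$) a complexity in $$O(n^{3k_0+7}).$$
   Context: Setting. $\mathbb{T}^d_a$ is the $d$-dimensional torus of side $a$, with the distance induced by the uniform norm $\|x\|_\infty=\max_i|x_i|$. A binomial point process of $n$ points is a set of $n$ independent uniformly distributed points on $\mathbb{T}^d_a$. The Vietoris-Rips complex on these points is the abstract simplicial complex whose $k$-simplices are the sets of $k+1$ points that are pairwise within the connection distance $r$ of each other. Put $\theta=(r/a)^d$, which may depend on $n$, and assume $\theta\le(1/2)^d$. A property holds asymptotically almost surely if its probability tends to $1$ as $n\to\infty$. Simplicial notions. A $k$-simplex has $k+1$ vertices; a coface of a simplex is a simplex containing it. $\beta_k(S)$ is the dimension of $H_k(S)$ (simplicial homology over a field). The degree of a simplex $\sigma$ of $S$ is $D(\sigma)=\max\{d' : \sigma\subset\tau \text{ for some } d'\text{-simplex }\tau\text{ of }S\}$. The index of a $0$-simplex $x$ is $I(x)=\min\{D(\sigma):\sigma \text{ a }(k_0+1)\text{-simplex of }S\text{ containing }x\}$, with $I(x)=0$ if there is none. Reduction algorithm. Input: complex $S$, list $L$ of critical $0$-simplices, integer $k_0$. Compute $\beta_0(S),\dots,\beta_{k_0}(S)$, the degrees of all $(k_0+1)$-simplices, and the indices of all $0$-simplices; then set $I(x)=-1$ for every $x\in L$. Let $I_{\max}$ denote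 the maximum of the current indices. While $I_{\max}>k_0+1$: draw uniformly at random a $0$-simplex $\hat x$ with $I(\hat x)=I_{\max}$; let $S'$ be $S$ with $\hat x$ and all its cofaces removed; compute $\beta_0(S'),\dots,\beta_{k_0}(S')$. If $\beta_k(S')\ne\beta_k(S)$ for some $k\in\{0,\dots,k_0\}$, cancel the removal (keep $S$) and set $I(\hat x)=-1$. Otherwise, replace $S$ by $S'$, recompute the degrees of the $(k_0+1)$-simplices and the indices of all $0$-simplices whose current index is not $-1$. Update $I_{\max}$. When the loop ends, output $S$. Complexity means worst-case number of elementary operations. The complex is given by the list of all its simplices; field operations and inclusion tests between simplices have unit cost; Betti numbers are computed from the ranks of the boundary matrices, and the rank of an $n\times m$ matrix costs $O(nm\min(n,m))$. *)

theory Defs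
  imports
    "HOL-Probability.Probability"
    "HOL-Library.Landau_Symbols"
    "HOL-Algebra.AbelCoset"
    "Jordan_Normal_Form.Missing_VectorSpace"
begin

section \<open>Simplicial complexes and homology over a field\<close>

text \<open>A complex is the set of its (finite, nonempty) simplices. The order on the vertices only serves
  to orient the simplices.\<close>

definition faces :: "'v set set \<Rightarrow> nat \<Rightarrow> 'v set set" where
  "faces S k = {\<sigma> \<in> S. card \<sigma> = k + 1}"

definition vertices :: "'v set set \<Rightarrow> 'v set" where
  "vertices S = {x. {x} \<in> S}"

definition simplicial_complex :: "'v set set \<Rightarrow> bool" where
  "simplicial_complex S \<longleftrightarrow>
     (\<forall>\<sigma>\<in>S. finite \<sigma> \<and> \<sigma> \<noteq> {} \<and> (\<forall>\<tau>. \<tau> \<noteq> {} \<and> \<tau> \<subseteq> \<sigma> \<longrightarrow> \<tau> \<in> S))"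

text \<open>The coefficient of \<open>\<tau>\<close> in the boundary of \<open>\<sigma>\<close>: if \<open>\<tau>\<close> arises from
  \<open>\<sigma> = {v\<^sub>0 < \<dots> < v\<^sub>k}\<close> by deleting \<open>v\<^sub>i\<close>, then exactly \<open>i\<close> elements of \<open>\<tau>\<close> precede \<open>v\<^sub>i\<close>.\<close>

definition incidence :: "'v::linorder set \<Rightarrow> 'v set \<Rightarrow> 'f::field" where
  "incidence \<sigma> \<tau> = (if \<tau> \<subseteq> \<sigma> \<and> card \<sigma> = card \<tau> + 1
     then (- 1) ^ card {w \<in> \<tau>. w < the_elem (\<sigma> - \<tau>)} else 0)"

definition chain_space :: "'v set set \<Rightarrow> nat \<Rightarrow> ('v set \<Rightarrow> 'f::field) set" where
  "chain_space S k = {c. \<forall>\<sigma>. \<sigma> \<notin> faces S k \<longrightarrow> c \<sigma> = 0}"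

text \<open>As the empty set is not a simplex, the boundary of a \<open>0\<close>-chain is zero.\<close>

definition boundary :: "'v::linorder set set \<Rightarrow> ('v set \<Rightarrow> 'f::field) \<Rightarrow> 'v set \<Rightarrow> 'f" where
  "boundary S c = (\<lambda>\<tau>. if \<tau> \<in> S then \<Sum>\<sigma>\<in>S. incidence \<sigma> \<tau> * c \<sigma> else 0)"

definition cycles :: "'v::linorder set set \<Rightarrow> nat \<Rightarrow> ('v set \<Rightarrow> 'f::field) set" where
  "cycles S k = {c \<in> chain_space S k. boundary S c = (\<lambda>_. 0)}"

definition boundaries :: "'v::linorder set set \<Rightarrow> nat \<Rightarrow> ('v set \<Rightarrow> 'f::field) set" where
  "boundaries S k = boundary S ` chain_space S (k + 1)"

definition scalars :: "'f::field ring" where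
  "scalars = \<lparr>carrier = UNIV, mult = (*), one = 1, zero = 0, add = (+)\<rparr>"

text \<open>In the module records below, the fields \<open>mult\<close> and \<open>one\<close> play no role.\<close>

definition cycle_space :: "'v::linorder set set \<Rightarrow> nat \<Rightarrow> ('f::field, 'v set \<Rightarrow> 'f) module" where
  "cycle_space S k = \<lparr>carrier = cycles S k, mult = undefined, one = undefined,
     zero = (\<lambda>_. 0), add = (\<lambda>c c' \<sigma>. c \<sigma> + c' \<sigma>), smult = (\<lambda>a c \<sigma>. a * c \<sigma>)\<rparr>"

definition quotient_module :: "('f, 'c) module \<Rightarrow> 'c set \<Rightarrow> ('f, 'c set) module" where
  "quotient_module V W = \<lparr>carrier = a_rcosets\<^bsub>V\<^esub> W, mult = undefined, one = undefined,
     zero = W, add = set_add V, smult = (\<lambda>a A. \<Union>x\<in>A. W +>\<^bsub>V\<^esub> (a \<odot>\<^bsub>V\<^esub> x))\<rparr>"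

definition homology :: "'f::field itself \<Rightarrow> 'v::linorder set set \<Rightarrow> nat \<Rightarrow>
    ('f, ('v set \<Rightarrow> 'f) set) module" where
  "homology F S k = quotient_module (cycle_space S k) (boundaries S k)"

definition betti :: "'f::field itself \<Rightarrow> 'v::linorder set set \<Rightarrow> nat \<Rightarrow> nat" where
  "betti F S k = vectorspace.dim (scalars :: 'f ring) (homology F S k)"

text \<open>The homology of a finite complex is a vector space, so that \<open>vectorspace.dim\<close> is
  its dimension.\<close>

lemma vectorspace_quotient_module:
  fixes K :: "('f, 'k) ring_scheme" and V :: "('f, 'c) module"
  assumes V: "vectorspace K V" and W: "additive_subgroup W V"
    and sm: "\<And>a w. a \<in> carrier K \<Longrightarrow> w \<in> W \<Longrightarrow> a \<odot>\<^bsub>V\<^esub> w \<in> W"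
  shows "vectorspace K (quotient_module V W)"
proof -
  interpret V: vectorspace K V by (rule V)
  interpret W: abelian_subgroup W V
    by (rule abelian_subgroupI3[OF W V.abelian_group_axioms])
  let ?Q = "quotient_module V W"
  have car: "carrier ?Q = {W +>\<^bsub>V\<^esub> x |x. x \<in> carrier V}"
    by (auto simp: quotient_module_def A_RCOSETS_def')
  have sc: "a \<odot>\<^bsub>?Q\<^esub> (W +>\<^bsub>V\<^esub> x) = W +>\<^bsub>V\<^esub> (a \<odot>\<^bsub>V\<^esub> x)"
    if a: "a \<in> carrier K" and x: "x \<in> carrier V" for a x
  proof -
    have "W +>\<^bsub>V\<^esub> (a \<odot>\<^bsub>V\<^esub> y) = W +>\<^bsub>V\<^esub> (a \<odot>\<^bsub>V\<^esub> x)" if y: "y \<in> W +>\<^bsub>V\<^esub> x" for y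
    proof -
      from y obtain w where w: "w \<in> W" "y = w \<oplus>\<^bsub>V\<^esub> x"
        by (auto simp: a_r_coset_def')
      have "a \<odot>\<^bsub>V\<^esub> y = (a \<odot>\<^bsub>V\<^esub> w) \<oplus>\<^bsub>V\<^esub> (a \<odot>\<^bsub>V\<^esub> x)"
        using w a x W.a_Hcarr by (simp add: V.smult_r_distr)
      hence "a \<odot>\<^bsub>V\<^esub> y \<in> W +>\<^bsub>V\<^esub> (a \<odot>\<^bsub>V\<^esub> x)"
        using sm[OF a w(1)] by (auto simp: a_r_coset_def')
      thus ?thesis
        using W.a_repr_independence' a x by (metis V.smult_closed)
    qed
    moreover have "x \<in> W +>\<^bsub>V\<^esub> x" using x by (rule W.a_rcos_self)
    ultimately have "(\<Union>y\<in>W +>\<^bsub>V\<^esub> x. W +>\<^bsub>V\<^esub> (a \<odot>\<^bsub>V\<^esub> y)) = W +>\<^bsub>V\<^esub> (a \<odot>\<^bsub>V\<^esub> x)"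
      by blast
    thus ?thesis by (simp add: quotient_module_def)
  qed
  have ad: "(W +>\<^bsub>V\<^esub> x) \<oplus>\<^bsub>?Q\<^esub> (W +>\<^bsub>V\<^esub> y) = W +>\<^bsub>V\<^esub> (x \<oplus>\<^bsub>V\<^esub> y)"
    if "x \<in> carrier V" "y \<in> carrier V" for x y
    using W.a_rcos_sum[OF that] by (simp add: quotient_module_def)
  have ze: "\<zero>\<^bsub>?Q\<^esub> = W +>\<^bsub>V\<^esub> \<zero>\<^bsub>V\<^esub>"
    using W.a_subset by (simp add: quotient_module_def V.a_coset_add_zero)
  have "abelian_group ?Q"
  proof (rule abelian_groupI)
    fix A assume "A \<in> carrier ?Q"
    then obtain x where x: "x \<in> carrier V" "A = W +>\<^bsub>V\<^esub> x" by (auto simp: car)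
    have "(W +>\<^bsub>V\<^esub> (\<ominus>\<^bsub>V\<^esub> x)) \<oplus>\<^bsub>?Q\<^esub> A = \<zero>\<^bsub>?Q\<^esub>"
      using x by (simp add: ad ze V.l_neg)
    moreover have "W +>\<^bsub>V\<^esub> (\<ominus>\<^bsub>V\<^esub> x) \<in> carrier ?Q" using x by (auto simp: car)
    ultimately show "\<exists>B\<in>carrier ?Q. B \<oplus>\<^bsub>?Q\<^esub> A = \<zero>\<^bsub>?Q\<^esub>" by blast
  qed (auto simp: car ad ze V.a_ac)
  moreover have "module_axioms K ?Q"
    by unfold_locales (auto simp: car ad sc V.smult_l_distr V.smult_r_distr V.smult_assoc1)
  ultimately show ?thesis
    by (intro vectorspace.intro module.intro V.R.is_cring V.field_axioms)
qed

lemma field_scalars: "field (scalars :: 'f::field ring)"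
proof -
  have "abelian_group (scalars :: 'f ring)"
  proof (rule abelian_groupI)
    fix x :: 'f
    show "\<exists>y\<in>carrier scalars. y \<oplus>\<^bsub>scalars\<^esub> x = \<zero>\<^bsub>scalars\<^esub>"
      by (rule bexI[of _ "- x"]) (simp_all add: scalars_def)
  qed (simp_all add: scalars_def add_ac)
  moreover have "comm_monoid (scalars :: 'f ring)"
    by (rule comm_monoidI) (simp_all add: scalars_def mult_ac)
  ultimately have "cring (scalars :: 'f ring)"
    by (rule cringI) (simp add: scalars_def distrib_right)
  thus ?thesis
  proof (rule cring.cring_fieldI2)
    fix a :: 'f assume "a \<noteq> \<zero>\<^bsub>scalars\<^esub>"
    thus "\<exists>b\<in>carrier scalars. a \<otimes>\<^bsub>scalars\<^esub> b = \<one>\<^bsub>scalars\<^esub>"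
      by (intro bexI[of _ "inverse a"]) (simp_all add: scalars_def)
  qed (simp add: scalars_def)
qed

lemma boundary_lin:
  "boundary S (\<lambda>\<sigma>. c \<sigma> + c' \<sigma>) = (\<lambda>\<tau>. boundary S c \<tau> + boundary S c' \<tau>)"
  "boundary S (\<lambda>\<sigma>. a * c \<sigma>) = (\<lambda>\<tau>. a * boundary S c \<tau>)"
  "boundary S (\<lambda>_. 0) = (\<lambda>_. 0)"
  by (auto simp: boundary_def fun_eq_iff algebra_simps sum.distrib sum_distrib_left)

lemma boundary_boundary:
  fixes c :: "'v::linorder set \<Rightarrow> 'f::field"
  assumes S: "simplicial_complex S" and fin: "finite S"
  shows "boundary S (boundary S c) = (\<lambda>_. 0)"
proof
  fix \<rho>
  have fs: "finite \<sigma>" if "\<sigma> \<in> S" for \<sigma> using S that unfolding simplicial_complex_def by blast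
  show "boundary S (boundary S c) \<rho> = 0"
  proof (cases "\<rho> \<in> S")
    case True
    have key: "(\<Sum>\<tau>\<in>S. incidence \<sigma> \<tau> * incidence \<tau> \<rho>) = (0::'f)" if \<sigma>: "\<sigma> \<in> S" for \<sigma>
    proof (cases "\<exists>u v. u < v \<and> u \<notin> \<rho> \<and> v \<notin> \<rho> \<and> \<sigma> = insert u (insert v \<rho>)")
      case True
      then obtain u v where uv: "u < v" "u \<notin> \<rho>" "v \<notin> \<rho>" "\<sigma> = insert u (insert v \<rho>)" by blast
      have fr: "finite \<rho>" by (rule fs[OF \<open>\<rho> \<in> S\<close>])
      have inS: "insert u \<rho> \<in> S" "insert v \<rho> \<in> S"
      proof -
        have sub: "\<tau> \<in> S" if "\<tau> \<noteq> {}" "\<tau> \<subseteq> \<sigma>" for \<tau>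
          using S \<sigma> that unfolding simplicial_complex_def by blast
        show "insert u \<rho> \<in> S" by (rule sub) (auto simp: uv(4))
        show "insert v \<rho> \<in> S" by (rule sub) (auto simp: uv(4))
      qed
      have z: "incidence \<sigma> \<tau> * incidence \<tau> \<rho> = (0::'f)"
        if "\<tau> \<in> S - {insert u \<rho>, insert v \<rho>}" for \<tau>
      proof (rule ccontr)
        assume "\<not> ?thesis"
        hence h: "\<tau> \<subseteq> \<sigma>" "\<rho> \<subseteq> \<tau>" "card \<tau> = card \<rho> + 1"
          by (auto simp: incidence_def split: if_splits)
        have "card (\<tau> - \<rho>) = 1"
          using h fr by (simp add: card_Diff_subset)
        then obtain w where w: "\<tau> - \<rho> = {w}" by (auto simp: card_1_singleton_iff)
        hence "\<tau> = insert w \<rho>" using h by auto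
        moreover have "w = u \<or> w = v" using w h uv by auto
        ultimately show False using that by auto
      qed
      have ne: "insert u \<rho> \<noteq> insert v \<rho>" using uv by auto
      have "(\<Sum>\<tau>\<in>S. incidence \<sigma> \<tau> * incidence \<tau> \<rho>)
          = (\<Sum>\<tau>\<in>{insert u \<rho>, insert v \<rho>}. incidence \<sigma> \<tau> * incidence \<tau> \<rho> :: 'f)"
        using fin inS z by (intro sum.mono_neutral_right) auto
      also have "\<dots> = incidence \<sigma> (insert u \<rho>) * incidence (insert u \<rho>) \<rho>
                  + incidence \<sigma> (insert v \<rho>) * incidence (insert v \<rho>) \<rho>"
        using ne by simp
      also have "\<dots> = 0"
      proof -
        have d: "\<sigma> - insert u \<rho> = {v}" "\<sigma> - insert v \<rho> = {u}"
          "insert u \<rho> - \<rho> = {u}" "insert v \<rho> - \<rho> = {v}" using uv by auto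
        have e: "{w \<in> insert u \<rho>. w < v} = insert u {w \<in> \<rho>. w < v}"
          "{w \<in> insert v \<rho>. w < u} = {w \<in> \<rho>. w < u}" using uv by auto
        have ce: "card \<sigma> = card \<rho> + 2" using uv fr by simp
        have sub: "insert u \<rho> \<subseteq> \<sigma>" "insert v \<rho> \<subseteq> \<sigma>" using uv(4) by auto
        have "incidence \<sigma> (insert u \<rho>) = - ((- 1) ^ card {w \<in> \<rho>. w < v} :: 'f)"
          using sub uv(2,3) fr unfolding incidence_def d e ce the_elem_eq by simp
        moreover have "incidence \<sigma> (insert v \<rho>) = ((- 1) ^ card {w \<in> \<rho>. w < u} :: 'f)"
          using sub uv(2,3) fr unfolding incidence_def d e ce the_elem_eq by simp
        moreover have "incidence (insert u \<rho>) \<rho> = ((- 1) ^ card {w \<in> \<rho>. w < u} :: 'f)"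
          using uv(2) fr unfolding incidence_def d the_elem_eq by (simp add: subset_insertI)
        moreover have "incidence (insert v \<rho>) \<rho> = ((- 1) ^ card {w \<in> \<rho>. w < v} :: 'f)"
          using uv(3) fr unfolding incidence_def d the_elem_eq by (simp add: subset_insertI)
        ultimately show ?thesis by simp
      qed
      finally show ?thesis .
    next
      case False
      have "incidence \<sigma> \<tau> * incidence \<tau> \<rho> = (0::'f)" if "\<tau> \<in> S" for \<tau>
      proof (rule ccontr)
        assume "\<not> ?thesis"
        hence h: "\<tau> \<subseteq> \<sigma>" "\<rho> \<subseteq> \<tau>" "card \<tau> = card \<rho> + 1" "card \<sigma> = card \<tau> + 1"
          by (auto simp: incidence_def split: if_splits)
        have "card (\<sigma> - \<rho>) = 2"
          using h fs[OF \<open>\<rho> \<in> S\<close>] by (subst card_Diff_subset) auto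
        then obtain u v where "\<sigma> - \<rho> = {u, v}" "u \<noteq> v" by (auto simp: card_2_iff)
        hence "\<sigma> = insert u (insert v \<rho>)" "u \<notin> \<rho>" "v \<notin> \<rho>" using h by auto
        with \<open>u \<noteq> v\<close> False show False by (metis insert_commute linorder_neqE)
      qed
      thus ?thesis by (intro sum.neutral) auto
    qed
    have "boundary S (boundary S c) \<rho>
        = (\<Sum>\<tau>\<in>S. incidence \<tau> \<rho> * (\<Sum>\<sigma>\<in>S. incidence \<sigma> \<tau> * c \<sigma>))"
      using True by (simp add: boundary_def)
    also have "\<dots> = (\<Sum>\<sigma>\<in>S. (\<Sum>\<tau>\<in>S. incidence \<sigma> \<tau> * incidence \<tau> \<rho>) * c \<sigma>)"
      unfolding sum_distrib_left sum_distrib_right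
      by (subst sum.swap) (simp add: mult_ac)
    finally show ?thesis using key by simp
  qed (simp add: boundary_def)
qed

lemma boundaries_subset_cycles:
  assumes S: "simplicial_complex S" and fin: "finite S"
  shows "(boundaries S k :: ('v::linorder set \<Rightarrow> 'f::field) set) \<subseteq> cycles S k"
proof -
  have "boundary S c \<tau> = 0" if c: "c \<in> chain_space S (k + 1)" and \<tau>: "\<tau> \<notin> faces S k"
    for c :: "'v set \<Rightarrow> 'f" and \<tau>
  proof (cases "\<tau> \<in> S")
    case True
    have "incidence \<sigma> \<tau> * c \<sigma> = 0" if "\<sigma> \<in> S" for \<sigma>
      using c \<tau> True that by (auto simp: chain_space_def faces_def incidence_def)
    hence "(\<Sum>\<sigma>\<in>S. incidence \<sigma> \<tau> * c \<sigma>) = 0" by (intro sum.neutral) blast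
    thus ?thesis by (simp add: boundary_def)
  qed (simp add: boundary_def)
  thus ?thesis using boundary_boundary[OF assms]
    by (auto simp: boundaries_def cycles_def chain_space_def)
qed

lemma vectorspace_homology:
  assumes S: "simplicial_complex S" and fin: "finite S"
  shows "vectorspace (scalars :: 'f::field ring) (homology TYPE('f) S k)"
proof -
  interpret F: field "scalars :: 'f ring" by (rule field_scalars)
  let ?Z = "cycle_space S k :: ('f, 'a set \<Rightarrow> 'f) module"
  have ag: "abelian_group ?Z"
  proof (rule abelian_groupI)
    fix c :: "'a set \<Rightarrow> 'f" assume "c \<in> carrier ?Z"
    thus "\<exists>y\<in>carrier ?Z. y \<oplus>\<^bsub>?Z\<^esub> c = \<zero>\<^bsub>?Z\<^esub>"
      using boundary_lin(2)[of S "- 1" c]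
      by (intro bexI[of _ "\<lambda>\<sigma>. - 1 * c \<sigma>"])
        (simp_all add: cycle_space_def cycles_def chain_space_def)
  qed (auto simp: cycle_space_def cycles_def chain_space_def boundary_lin add_ac)
  moreover have "module_axioms (scalars :: 'f ring) ?Z"
    by unfold_locales
      (auto simp: cycle_space_def cycles_def chain_space_def boundary_lin scalars_def algebra_simps)
  ultimately have V: "vectorspace (scalars :: 'f ring) ?Z"
    by (intro vectorspace.intro module.intro F.is_cring F.field_axioms)
  interpret V: vectorspace "scalars :: 'f ring" ?Z by (rule V)
  have zero_mem: "(\<lambda>_. 0) \<in> (boundaries S k :: ('a set \<Rightarrow> 'f) set)"
    unfolding boundaries_def
    by (rule image_eqI[of _ _ "\<lambda>_. 0"]) (simp_all add: boundary_lin chain_space_def)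
  have add_mem: "(\<lambda>\<sigma>. b \<sigma> + b' \<sigma>) \<in> boundaries S k"
    if "b \<in> boundaries S k" "b' \<in> boundaries S k" for b b' :: "'a set \<Rightarrow> 'f"
  proof -
    from that obtain c c' where c: "c \<in> chain_space S (k + 1)" "c' \<in> chain_space S (k + 1)"
      "b = boundary S c" "b' = boundary S c'" unfolding boundaries_def by blast
    thus ?thesis unfolding boundaries_def
      by (intro image_eqI[of _ _ "\<lambda>\<sigma>. c \<sigma> + c' \<sigma>"]) (simp_all add: boundary_lin chain_space_def)
  qed
  have smult_mem: "(\<lambda>\<sigma>. a * b \<sigma>) \<in> boundaries S k" if "b \<in> boundaries S k"
    for a and b :: "'a set \<Rightarrow> 'f"
  proof -
    from that obtain c where c: "c \<in> chain_space S (k + 1)" "b = boundary S c"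
      unfolding boundaries_def by blast
    thus ?thesis unfolding boundaries_def
      by (intro image_eqI[of _ _ "\<lambda>\<sigma>. a * c \<sigma>"]) (simp_all add: boundary_lin chain_space_def)
  qed
  have "additive_subgroup (boundaries S k) ?Z"
  proof (rule additive_subgroupI, rule group.subgroupI[OF V.a_group])
    show "boundaries S k \<subseteq> carrier (add_monoid ?Z)"
      using boundaries_subset_cycles[OF assms] by (simp add: cycle_space_def)
    show "boundaries S k \<noteq> ({} :: ('a set \<Rightarrow> 'f) set)" using zero_mem by blast
    fix b :: "'a set \<Rightarrow> 'f" assume b: "b \<in> boundaries S k"
    have bZ: "b \<in> carrier ?Z" "(\<lambda>\<sigma>. - 1 * b \<sigma>) \<in> carrier ?Z"
      using boundaries_subset_cycles[OF assms] b smult_mem[OF b, of "- 1"] by (auto simp: cycle_space_def)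
    have "\<ominus>\<^bsub>?Z\<^esub> b = (\<lambda>\<sigma>. - 1 * b \<sigma>)"
      by (rule V.minus_equality[OF _ bZ]) (simp add: cycle_space_def)
    thus "inv\<^bsub>add_monoid ?Z\<^esub> b \<in> boundaries S k"
      using smult_mem[OF b, of "- 1"] by (simp add: a_inv_def)
    fix b' :: "'a set \<Rightarrow> 'f" assume b': "b' \<in> boundaries S k"
    show "b \<otimes>\<^bsub>add_monoid ?Z\<^esub> b' \<in> boundaries S k"
      using add_mem[OF b b'] by (simp add: cycle_space_def)
  qed
  thus ?thesis unfolding homology_def
    by (rule vectorspace_quotient_module[OF V]) (use smult_mem in \<open>auto simp: cycle_space_def\<close>)
qed


section \<open>The reduction algorithm\<close>

definition simplex_degree :: "'v set set \<Rightarrow> 'v set \<Rightarrow> nat" where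
  "simplex_degree S \<sigma> = Max {d. \<exists>\<tau>\<in>S. card \<tau> = d + 1 \<and> \<sigma> \<subseteq> \<tau>}"

definition vertex_index :: "nat \<Rightarrow> 'v set set \<Rightarrow> 'v \<Rightarrow> nat" where
  "vertex_index k0 S x =
     (if \<exists>\<sigma>\<in>faces S (k0 + 1). x \<in> \<sigma>
      then Min {simplex_degree S \<sigma> |\<sigma>. \<sigma> \<in> faces S (k0 + 1) \<and> x \<in> \<sigma>} else 0)"

definition remove_vertex :: "'v \<Rightarrow> 'v set set \<Rightarrow> 'v set set" where
  "remove_vertex x S = {\<sigma> \<in> S. x \<notin> \<sigma>}"

text \<open>Indices are at least \<open>-1\<close>, so the inserted \<open>-1\<close> only matters for the empty complex.\<close>

definition max_index :: "'v set set \<Rightarrow> ('v \<Rightarrow> int) \<Rightarrow> int" where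
  "max_index S I = Max (insert (- 1) (I ` vertices S))"

subsection \<open>Elementary operations of the parts of the algorithm\<close>

text \<open>A complex \<open>S\<close> is given by the list of its \<open>card S\<close> simplices, and to select from this list
  the simplices of a given dimension means to run through it. Inclusion tests, field operations,
  comparisons, assignments and random draws cost \<open>1\<close>. The argument \<open>rk\<close> is the cost of computing
  the rank of a matrix with the given numbers of rows and columns.\<close>

text \<open>Betti numbers \<open>0, \<dots>, k0\<close>: select the simplices of dimensions \<open>0, \<dots>, k0 + 1\<close>; fill in the
  boundary matrices in dimensions \<open>1, \<dots>, k0 + 1\<close> with, per entry, one inclusion test and the
  search for the place of the missing vertex among \<open>k + 1\<close> vertices; compute their ranks;
  subtract twice per Betti number.\<close>

definition betti_ops :: "(nat \<Rightarrow> nat \<Rightarrow> nat) \<Rightarrow> nat \<Rightarrow> 'v set set \<Rightarrow> nat" where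
  "betti_ops rk k0 S =
     (k0 + 2) * card S
     + (\<Sum>k=1..k0+1. (k + 2) * (card (faces S (k - 1)) * card (faces S k))
                      + rk (card (faces S (k - 1))) (card (faces S k)))
     + 2 * (k0 + 1)"

text \<open>Degrees: test every \<open>(k0+1)\<close>-simplex for inclusion in every simplex and update a maximum.\<close>

definition degree_ops :: "nat \<Rightarrow> 'v set set \<Rightarrow> nat" where
  "degree_ops k0 S = card S + card (faces S (k0 + 1)) * (2 * card S)"

text \<open>Indices: for every vertex check whether its index is \<open>-1\<close>, test it for inclusion in every
  \<open>(k0+1)\<close>-simplex and update a minimum.\<close>

definition index_ops :: "nat \<Rightarrow> 'v set set \<Rightarrow> nat" where
  "index_ops k0 S = card S + card (vertices S) * (1 + 2 * card (faces S (k0 + 1)))"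

definition max_index_ops :: "'v set set \<Rightarrow> nat" where
  "max_index_ops S = card S + card (vertices S)"

text \<open>Drawing a vertex: collect the vertices of maximal index, then draw one of them.\<close>

definition draw_ops :: "'v set set \<Rightarrow> nat" where
  "draw_ops S = card S + card (vertices S) + 1"

definition removal_ops :: "'v set set \<Rightarrow> nat" where
  "removal_ops S = card S"

subsection \<open>Runs and complexity\<close>

text \<open>The component \<open>ops\<close> counts the elementary operations performed so far.\<close>

record 'v state =
  cpx :: "'v set set"
  idx :: "'v \<Rightarrow> int"
  ops :: nat

definition initial_state :: "(nat \<Rightarrow> nat \<Rightarrow> nat) \<Rightarrow> nat \<Rightarrow> 'v set set \<Rightarrow> 'v list \<Rightarrow> 'v state" where
  "initial_state rk k0 S L =
     \<lparr>cpx = S,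
      idx = (\<lambda>x. if x \<in> set L then - 1 else int (vertex_index k0 S x)),
      ops = betti_ops rk k0 S + degree_ops k0 S + index_ops k0 S + length L + max_index_ops S\<rparr>"

text \<open>One pass through the loop body, the vertex \<open>x\<close> having been drawn. The summands \<open>1\<close> and
  \<open>k0 + 1\<close> of \<open>c\<close> count the test of the loop condition and the comparison of the Betti numbers.\<close>

definition try_remove :: "'f::field itself \<Rightarrow> (nat \<Rightarrow> nat \<Rightarrow> nat) \<Rightarrow> nat \<Rightarrow>
    'v::linorder state \<Rightarrow> 'v \<Rightarrow> 'v state" where
  "try_remove F rk k0 s x =
     (let S = cpx s; S' = remove_vertex x S;
          c = ops s + 1 + draw_ops S + removal_ops S + betti_ops rk k0 S' + (k0 + 1)
      in if \<exists>k\<le>k0. betti F S' k \<noteq> betti F S k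
         then \<lparr>cpx = S,
               idx = (idx s)(x := - 1),
               ops = c + 1 + max_index_ops S\<rparr>
         else \<lparr>cpx = S',
               idx = (\<lambda>y. if idx s y = - 1 then - 1 else int (vertex_index k0 S' y)),
               ops = c + degree_ops k0 S' + index_ops k0 S' + max_index_ops S'\<rparr>)"

definition running :: "nat \<Rightarrow> 'v state \<Rightarrow> bool" where
  "running k0 s \<longleftrightarrow> max_index (cpx s) (idx s) > int (k0 + 1)"

definition loop_step :: "'f::field itself \<Rightarrow> (nat \<Rightarrow> nat \<Rightarrow> nat) \<Rightarrow> nat \<Rightarrow>
    'v::linorder state \<Rightarrow> 'v state pmf" where
  "loop_step F rk k0 s =
     (if running k0 s
      then map_pmf (try_remove F rk k0 s)
             (pmf_of_set {x \<in> vertices (cpx s). idx s x = max_index (cpx s) (idx s)})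
      else return_pmf s)"

primrec run :: "'f::field itself \<Rightarrow> (nat \<Rightarrow> nat \<Rightarrow> nat) \<Rightarrow> nat \<Rightarrow>
    'v::linorder set set \<Rightarrow> 'v list \<Rightarrow> nat \<Rightarrow> 'v state pmf" where
  "run F rk k0 S L 0 = return_pmf (initial_state rk k0 S L)"
| "run F rk k0 S L (Suc t) = bind_pmf (run F rk k0 S L t) (loop_step F rk k0)"

text \<open>When the loop ends, the condition is tested once more and the list of simplices is output.\<close>

definition total_ops :: "nat \<Rightarrow> 'v state \<Rightarrow> nat" where
  "total_ops k0 s = ops s + (if running k0 s then 0 else 1 + card (cpx s))"

text \<open>The worst case over all random draws; it is infinite if the algorithm need not terminate,
  since each pass through the loop performs at least one operation.\<close>

definition complexity :: "'f::field itself \<Rightarrow> (nat \<Rightarrow> nat \<Rightarrow> nat) \<Rightarrow> nat \<Rightarrow>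
    'v::linorder set set \<Rightarrow> 'v list \<Rightarrow> enat" where
  "complexity F rk k0 S L = (SUP t. SUP s\<in>set_pmf (run F rk k0 S L t). enat (total_ops k0 s))"


section \<open>Random points on the torus\<close>

text \<open>The torus of side \<open>a\<close> is the quotient of \<open>real ^ 'd\<close> by the lattice of the multiples of \<open>a\<close>,
  with the quotient metric of the uniform norm; its points are represented in the fundamental
  domain.\<close>

definition torus_domain :: "real \<Rightarrow> (real ^ 'd) set" where
  "torus_domain a = {x. \<forall>i. 0 \<le> x $ i \<and> x $ i < a}"

definition torus_dist :: "real \<Rightarrow> real ^ 'd \<Rightarrow> real ^ 'd \<Rightarrow> real" where
  "torus_dist a x y = (INF z :: int ^ 'd. infnorm (x - y + (\<chi> i. a * of_int (z $ i))))"

text \<open>The points are labelled by \<open>{..<n}\<close>. They are almost surely distinct, so that the labels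
  can serve as the vertices of the Vietoris-Rips complex.\<close>

definition binomial_point_process ::
    "'w measure \<Rightarrow> (nat \<Rightarrow> 'w \<Rightarrow> real ^ 'd) \<Rightarrow> nat \<Rightarrow> real \<Rightarrow> bool" where
  "binomial_point_process M X n a \<longleftrightarrow>
     prob_space M \<and> prob_space.indep_vars M (\<lambda>_. borel) X {..<n} \<and>
     (\<forall>i<n. distr M borel (X i) = uniform_measure lborel (torus_domain a))"

definition rips_complex :: "real \<Rightarrow> real \<Rightarrow> (nat \<Rightarrow> real ^ 'd) \<Rightarrow> nat \<Rightarrow> nat set set" where
  "rips_complex a r x n =
     {\<sigma>. \<sigma> \<noteq> {} \<and> \<sigma> \<subseteq> {..<n} \<and> pairwise (\<lambda>i j. torus_dist a (x i) (x j) \<le> r) \<sigma>}"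

definition asymptotically_almost_surely ::
    "(nat \<Rightarrow> 'w measure) \<Rightarrow> (nat \<Rightarrow> 'w \<Rightarrow> bool) \<Rightarrow> bool" where
  "asymptotically_almost_surely M P \<longleftrightarrow>
     (\<lambda>n. measure (M n) {\<omega> \<in> space (M n). P n \<omega>}) \<longlonglongrightarrow> 1"

end

theory Submission
  imports Defs
begin

text \<open>Every pass through the loop retires one vertex, so there are at most \<open>n\<close> passes, and the cost of
  a pass is polynomial in \<open>n\<close> and linear in the total number of simplices. If a nonempty set
  of \<open>m\<close> points spans a simplex, then all but one of them lie in the ball of radius \<open>r\<close> about the
  remaining one, and this has probability at most \<open>(6\<^sup>d \<theta>)\<^bsup>m - 1\<^esup>\<close>: modulo the lattice, \<open>3\<^sup>d\<close> cubes
  of side \<open>2 r\<close> cover the ball in the fundamental domain. Hence the expected number of simplices is at most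
  \<open>n (1 + 6\<^sup>d \<theta>)\<^sup>n \<le> n exp (6\<^sup>d n \<theta>)\<close>, which is \<open>O(n)\<close> in the subcritical regime, and by
  Markov's inequality there are asymptotically almost surely at most \<open>n\<^sup>2\<close> simplices.\<close>

section \<open>The cost of a run\<close>

text \<open>A \<open>k\<close>-simplex is a \<open>(k + 1)\<close>-subset of the \<open>n\<close>
  labels, so a binomial coefficient bounds their number; for \<open>k + 1 > n\<close> there are
  none.\<close>

lemma card_faces_le:
  assumes "S \<subseteq> Pow {..<n}"
  shows "card (faces S k) \<le> n ^ (k + 1)"
proof (cases "k + 1 \<le> n")
  case True
  have "card (faces S k) \<le> card {\<sigma>. \<sigma> \<subseteq> {..<n} \<and> card \<sigma> = k + 1}"
    using assms by (intro card_mono) (auto simp: faces_def)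
  also have "\<dots> = n choose (k + 1)"
    by (subst n_subsets) auto
  also have "\<dots> \<le> n ^ (k + 1)"
    using True by (rule binomial_le_pow)
  finally show ?thesis .
next
  case False
  have "card \<sigma> \<le> n" if "\<sigma> \<in> S" for \<sigma>
    using assms that card_mono[of "{..<n}" \<sigma>] by auto
  with False have "faces S k = {}"
    unfolding faces_def by fastforce
  thus ?thesis by simp
qed

lemma vertices_remove_vertex: "vertices (remove_vertex x S) = vertices S - {x}"
  by (auto simp: vertices_def remove_vertex_def)

lemma remove_vertex_subset: "remove_vertex x S \<subseteq> S"
  by (auto simp: remove_vertex_def)

lemma vertices_subset:
  "S \<subseteq> Pow A \<Longrightarrow> vertices S \<subseteq> A"
  by (auto simp: vertices_def)

lemma card_vertices_le: "S \<subseteq> Pow {..<n} \<Longrightarrow> card (vertices S) \<le> n"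
  using card_mono[of "{..<n}" "vertices S"] vertices_subset[of S "{..<n}"] by simp

text \<open>The largest boundary matrix, for \<open>k = k0 + 1\<close>, has at most
  \<open>n ^ (k0 + 1)\<close> rows and \<open>n ^ (k0 + 2)\<close> columns, so its rank costs
  \<open>n ^ (3 * k0 + 4)\<close> up to a constant. Every other term has a smaller or equal
  exponent.\<close>

lemma betti_ops_le:
  assumes S: "S \<subseteq> Pow {..<n}" "card S \<le> n\<^sup>2" and n: "n > 0"
    and rk: "\<And>p q. rk p q \<le> K * (p * q * min p q + 1)"
  shows "betti_ops rk k0 S \<le> (k0 + 1) * (k0 + 2 * K + 7) * n ^ (3 * k0 + 4)"
proof -
  let ?Q = "n ^ (3 * k0 + 4)"
  have Q: "n ^ j \<le> ?Q" if "j \<le> 3 * k0 + 4" for j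
    using n that by (intro power_increasing) auto
  have Q1: "1 \<le> ?Q" using n by simp
  have "(k + 2) * (card (faces S (k - 1)) * card (faces S k))
          + rk (card (faces S (k - 1))) (card (faces S k)) \<le> (k0 + 3 + 2 * K) * ?Q"
    if k: "k \<in> {1..k0+1}" for k
  proof -
    let ?p = "card (faces S (k - 1))" and ?q = "card (faces S k)"
    have p: "?p \<le> n ^ k"
      using card_faces_le[OF S(1), of "k - 1"] k by (simp del: power_Suc)
    have q: "?q \<le> n ^ (k + 1)" by (rule card_faces_le[OF S(1)])
    have "?p * ?q \<le> n ^ k * n ^ (k + 1)" by (rule mult_le_mono[OF p q])
    also have "\<dots> = n ^ (2 * k + 1)" by (simp flip: power_add add: mult_2)
    finally have pq: "?p * ?q \<le> n ^ (2 * k + 1)" .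
    have "?p * ?q * min ?p ?q \<le> n ^ (2 * k + 1) * n ^ k"
      using p by (intro mult_le_mono pq) auto
    also have "\<dots> = n ^ (3 * k + 1)" by (simp flip: power_add)
    also have "\<dots> \<le> ?Q" using k by (intro Q) auto
    finally have pqm: "?p * ?q * min ?p ?q \<le> ?Q" .
    \<comment> \<open>The second \<open>?Q\<close> absorbs the \<open>+ 1\<close> in the assumed
      rank cost.\<close>
    have "rk ?p ?q \<le> K * (?Q + ?Q)"
      by (rule order_trans[OF rk]) (intro mult_le_mono add_mono order_refl pqm Q1)
    moreover have "(k + 2) * (?p * ?q) \<le> (k0 + 3) * ?Q"
      using k by (intro mult_le_mono order_trans[OF pq] Q) auto
    moreover have "K * (?Q + ?Q) = 2 * K * ?Q" by simp
    ultimately show ?thesis unfolding add_mult_distrib by linarith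
  qed
  hence "(\<Sum>k=1..k0+1. (k + 2) * (card (faces S (k - 1)) * card (faces S k))
          + rk (card (faces S (k - 1))) (card (faces S k)))
      \<le> (k0 + 1) * ((k0 + 3 + 2 * K) * ?Q)"
    by (rule order_trans[OF sum_bounded_above]) simp_all
  \<comment> \<open>Here \<open>k0 + 2 \<le> 2 * (k0 + 1)\<close> makes \<open>k0 + 1\<close> a
    common factor of all three summands. The 7 of the final constant is 2 from this term, 3 from the
    matrices and 2 from the subtractions.\<close>
  moreover have "(k0 + 2) * card S \<le> 2 * (k0 + 1) * ?Q"
    using order_trans[OF S(2) Q[of 2]] by (intro mult_le_mono) auto
  moreover have "2 * (k0 + 1) \<le> 2 * (k0 + 1) * ?Q"
    using mult_le_mono2[OF Q1, of "2 * (k0 + 1)"] by simp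
  ultimately have "betti_ops rk k0 S
      \<le> 2 * (k0 + 1) * ?Q + (k0 + 1) * ((k0 + 3 + 2 * K) * ?Q) + 2 * (k0 + 1) * ?Q"
    unfolding betti_ops_def by linarith
  also have "\<dots> = (k0 + 1) * (2 + (k0 + 3 + 2 * K) + 2) * ?Q"
    by (simp only: add_mult_distrib add_mult_distrib2 mult_ac)
  also have "2 + (k0 + 3 + 2 * K) + 2 = k0 + 2 * K + 7" by simp
  finally show ?thesis .
qed

text \<open>Only the inserted -1 can be a maximum without coming from a vertex, so a running loop
  always has a vertex to draw.\<close>

lemma max_index_attained:
  assumes "finite (vertices S)" "max_index S I > - 1"
  shows "\<exists>x\<in>vertices S. I x = max_index S I"
proof -
  have "max_index S I \<in> insert (- 1) (I ` vertices S)"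
    unfolding max_index_def using assms(1) by (intro Max_in) auto
  thus ?thesis using assms(2) by auto
qed

text \<open>While the loop runs, the maximal index exceeds \<open>k0 + 1\<close>, so no vertex of
  index -1 is drawn. The set of candidates is finite and nonempty and is therefore the support of
  the draw.\<close>

lemma set_pmf_loop_step:
  assumes "finite (vertices (cpx s))"
  shows "set_pmf (loop_step F rk k0 s) \<subseteq>
    (if running k0 s
     then try_remove F rk k0 s ` {x \<in> vertices (cpx s). idx s x \<noteq> - 1} else {s})"
proof (cases "running k0 s")
  case True
  hence m: "max_index (cpx s) (idx s) > - 1" by (simp add: running_def)
  let ?A = "{x \<in> vertices (cpx s). idx s x = max_index (cpx s) (idx s)}"
  have "?A \<noteq> {}" using max_index_attained[OF assms m] by blast
  moreover have "finite ?A" using assms by simp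
  ultimately show ?thesis using True m by (auto simp: loop_step_def)
qed (simp add: loop_step_def)

text \<open>Each pass through the loop decreases \<open>active s\<close>: the vertex drawn is removed or its index
  becomes \<open>-1\<close>.\<close>

definition active :: "'v state \<Rightarrow> 'v set" where
  "active s = {x \<in> vertices (cpx s). idx s x \<noteq> - 1}"

text \<open>No vertex becomes active again: recomputation leaves every index -1 as it is, and
  removal creates no vertices.\<close>

lemma active_try_remove: "active (try_remove F rk k0 s x) \<subseteq> active s - {x}"
  by (auto simp: active_def try_remove_def Let_def vertices_remove_vertex split: if_splits)

lemma cpx_try_remove: "cpx (try_remove F rk k0 s x) \<subseteq> cpx s"
  by (auto simp: try_remove_def Let_def remove_vertex_def)

section \<open>Runs started at a complex with at most n^2 simplices\<close>

context
  fixes rk :: "nat \<Rightarrow> nat \<Rightarrow> nat" and K k0 n :: nat and S0 :: "nat set set"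
  assumes rk: "\<And>p q. rk p q \<le> K * (p * q * min p q + 1)"
    and n: "n > 0" and S0: "S0 \<subseteq> Pow {..<n}" and cS0: "card S0 \<le> n\<^sup>2"
begin

lemma finite_subcomplex: "S \<subseteq> S0 \<Longrightarrow> finite S"
  using S0 by (meson finite_Pow_iff finite_lessThan finite_subset)

text \<open>\<open>S\<close> stands for any complex met during the run; as a subset of
  \<open>S0\<close> it inherits the bounds on labels and on the number of simplices.\<close>

lemma parts_ops_le:
  assumes "S \<subseteq> S0"
  defines "Q \<equiv> n ^ (3 * k0 + 4)"
  shows "betti_ops rk k0 S \<le> (k0 + 1) * (k0 + 2 * K + 7) * Q" "degree_ops k0 S \<le> 3 * Q"
    "index_ops k0 S \<le> 4 * Q" "max_index_ops S \<le> 2 * Q" "draw_ops S \<le> 3 * Q"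
    "removal_ops S \<le> Q" "n \<le> Q" "1 \<le> Q" "card S \<le> Q"
proof -
  have Q: "n ^ j \<le> Q" if "j \<le> 3 * k0 + 4" for j
    unfolding Q_def using n that by (intro power_increasing) auto
  have S: "S \<subseteq> Pow {..<n}" using assms S0 by blast
  have cS: "card S \<le> n\<^sup>2"
    using card_mono[OF finite_subcomplex[OF order_refl] assms(1)] cS0 by linarith
  show "betti_ops rk k0 S \<le> (k0 + 1) * (k0 + 2 * K + 7) * Q"
    unfolding Q_def by (rule betti_ops_le[OF S cS n rk])
  show n1: "n \<le> Q" "1 \<le> Q" using Q[of 1] Q[of 0] by auto
  show cS': "card S \<le> Q" using cS Q[of 2] by auto
  have v: "card (vertices S) \<le> n" by (rule card_vertices_le[OF S])
  show "removal_ops S \<le> Q" "max_index_ops S \<le> 2 * Q" "draw_ops S \<le> 3 * Q"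
    using cS' v n1 by (simp_all add: removal_ops_def max_index_ops_def draw_ops_def)
  have f: "card (faces S (k0 + 1)) \<le> n ^ (k0 + 2)" using card_faces_le[OF S, of "k0 + 1"] by simp
  \<comment> \<open>Only here is the total number of simplices multiplied by another count. The
    exponent \<open>k0 + 4\<close> just fits: it equals \<open>3 * k0 + 4\<close> for
    \<open>k0 = 0\<close>.\<close>
  have "card (faces S (k0 + 1)) * card S \<le> n ^ (k0 + 2) * n ^ 2"
    by (rule mult_le_mono[OF f cS])
  also have "\<dots> \<le> Q" unfolding power_add[symmetric] by (rule Q) simp
  finally show "degree_ops k0 S \<le> 3 * Q" using cS' by (simp add: degree_ops_def)
  have "card (vertices S) * card (faces S (k0 + 1)) \<le> n ^ 1 * n ^ (k0 + 2)"
    using v f by (intro mult_le_mono) auto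
  also have "\<dots> \<le> Q" unfolding power_add[symmetric] by (rule Q) simp
  finally show "index_ops k0 S \<le> 4 * Q"
    using cS' v n1 by (simp add: index_ops_def distrib_left)
qed

text \<open>The dominating term of a pass, kept opaque in the linear estimates.\<close>

definition betti_cost :: nat where
  "betti_cost = (k0 + 1) * (k0 + 2 * K + 7) * n ^ (3 * k0 + 4)"

text \<open>A common bound for one pass and for the initialisation. Besides the Betti numbers and
  their comparison, a pass needs 14 units of \<open>n ^ (3 * k0 + 4)\<close>: 1 for the loop test, 3
  for the draw, 1 for the removal, 9 for degrees, indices and the new maximum. The initialisation
  needs 10.\<close>

definition pass_cost :: nat where
  "pass_cost = betti_cost + (k0 + 1) * n ^ (3 * k0 + 4) + 15 * n ^ (3 * k0 + 4)"

lemma ops_try_remove: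
  assumes "cpx s \<subseteq> S0"
  shows "ops (try_remove F rk k0 s x) \<le> ops s + pass_cost"
proof -
  define Q where "Q = n ^ (3 * k0 + 4)"
  let ?S = "cpx s" and ?S' = "remove_vertex x (cpx s)"
  note S = parts_ops_le[OF assms, folded Q_def]
  note S' = parts_ops_le[OF order_trans[OF remove_vertex_subset[of x] assms], folded betti_cost_def Q_def]
  have k0: "k0 + 1 \<le> (k0 + 1) * Q"
    using mult_le_mono2[OF S(8), of "k0 + 1"] by simp
  \<comment> \<open>The maximum covers both outcomes of the Betti test; a cancelled removal costs at
    most \<open>3 * Q\<close> there, an accepted one at most \<open>9 * Q\<close>.\<close>
  have "ops (try_remove F rk k0 s x) \<le> ops s + 1 + draw_ops ?S + removal_ops ?S + betti_ops rk k0 ?S'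
      + (k0 + 1) + max (1 + max_index_ops ?S) (degree_ops k0 ?S' + index_ops k0 ?S' + max_index_ops ?S')"
    by (simp add: try_remove_def Let_def) (simp add: max.coboundedI2 add.assoc)
  also have "\<dots> \<le> ops s + Q + 3 * Q + Q + betti_cost + (k0 + 1) * Q + (3 * Q + 4 * Q + 2 * Q)"
    using S(4,8) by (intro add_mono max.boundedI order_refl S S' k0) linarith+
  finally show ?thesis unfolding pass_cost_def Q_def by linarith
qed

lemma ops_initial_state:
  assumes "distinct L" "set L \<subseteq> {..<n}"
  shows "ops (initial_state rk k0 S0 L) \<le> pass_cost"
proof -
  have "length L \<le> n"
    using assms card_mono[of "{..<n}" "set L"] by (simp add: distinct_card)
  thus ?thesis
    using parts_ops_le[OF order_refl, folded betti_cost_def]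
    unfolding initial_state_def pass_cost_def state.simps by linarith
qed

text \<open>A potential argument: each active vertex holds the budget of one pass, and a pass spends
  at most one budget while retiring at least one active vertex. The factor \<open>n + 1\<close>
  stands for \<open>n\<close> vertices and the initialisation.\<close>

lemma run_invariant:
  assumes L: "distinct L" "set L \<subseteq> {..<n}" and "s \<in> set_pmf (run F rk k0 S0 L t)"
  shows "cpx s \<subseteq> S0 \<and> ops s + card (active s) * pass_cost \<le> (n + 1) * pass_cost"
  using assms(3)
proof (induction t arbitrary: s)
  case 0
  hence s: "s = initial_state rk k0 S0 L" by simp
  hence "cpx s = S0" by (simp add: initial_state_def)
  moreover have "card (active s) \<le> n"
    using card_mono[of "{..<n}" "active s"] vertices_subset[OF S0] \<open>cpx s = S0\<close>
    by (auto simp: active_def)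
  hence "card (active s) * pass_cost \<le> n * pass_cost" by (rule mult_le_mono1)
  moreover have "ops s \<le> pass_cost" using ops_initial_state[OF L] s by simp
  ultimately have "ops s + card (active s) * pass_cost \<le> (n + 1) * pass_cost"
    unfolding add_mult_distrib by linarith
  thus ?case using \<open>cpx s = S0\<close> by simp
next
  case (Suc t)
  then obtain s' where s': "s' \<in> set_pmf (run F rk k0 S0 L t)" "s \<in> set_pmf (loop_step F rk k0 s')"
    by auto
  note IH = Suc.IH[OF s'(1)]
  have fin: "finite (vertices (cpx s'))"
    using IH S0 vertices_subset[of "cpx s'" "{..<n}"] by (meson finite_lessThan finite_subset order_trans)
  show ?case
  proof (cases "running k0 s'")
    case True
    then obtain x where x: "x \<in> active s'" "s = try_remove F rk k0 s' x"
      using set_pmf_loop_step[OF fin, of F rk k0] s'(2) by (auto simp: active_def)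
    have fa: "finite (active s')" using fin by (simp add: active_def)
    have "card (active s) \<le> card (active s' - {x})"
      unfolding x(2) using fa by (intro card_mono active_try_remove) auto
    also have "\<dots> < card (active s')"
      using x(1) fa by (intro psubset_card_mono) auto
    finally have "(card (active s) + 1) * pass_cost \<le> card (active s') * pass_cost"
      by (intro mult_le_mono1) simp
    hence "ops s + card (active s) * pass_cost \<le> (n + 1) * pass_cost"
      using IH ops_try_remove[of s' F x] unfolding x(2) add_mult_distrib mult_1 by linarith
    thus ?thesis
      using IH cpx_try_remove[of F rk k0 s' x] x(2) by blast
  next
    case False
    hence "s = s'" using set_pmf_loop_step[OF fin, of F rk k0] s'(2) by auto
    thus ?thesis using IH by blast
  qed
qed

text \<open>The invariant bounds all reachable states independently of \<open>t\<close>, so the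
  supremum is finite and the loop ends. The linear number of passes raises the exponent by
  one.\<close>

lemma complexity_le:
  assumes "distinct L" "set L \<subseteq> {..<n}"
  shows "complexity F rk k0 S0 L
    \<le> enat (4 * ((k0 + 1) * (k0 + 2 * K + 7) + (k0 + 1) + 15) * n ^ (3 * k0 + 5))"
  unfolding complexity_def
proof (intro SUP_least)
  fix t s assume "s \<in> set_pmf (run F rk k0 S0 L t)"
  hence s: "cpx s \<subseteq> S0" "ops s + card (active s) * pass_cost \<le> (n + 1) * pass_cost"
    using run_invariant[OF assms] by blast+
  \<comment> \<open>The last test and the output fit into one further \<open>pass_cost\<close>,
    whence \<open>n + 2\<close> below.\<close>
  have "1 + card (cpx s) \<le> 2 * n ^ (3 * k0 + 4)" using parts_ops_le(8,9)[OF s(1)] by simp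
  also have "\<dots> \<le> pass_cost" unfolding pass_cost_def by linarith
  finally have "1 + card (cpx s) \<le> pass_cost" .
  moreover have "ops s \<le> (n + 1) * pass_cost"
    using s(2) by linarith
  ultimately have "total_ops k0 s \<le> (n + 2) * pass_cost"
    unfolding total_ops_def add_mult_distrib by simp
  also have "\<dots> \<le> (4 * n) * pass_cost"
    using n by (intro mult_le_mono1) simp
  also have "\<dots> = 4 * ((k0 + 1) * (k0 + 2 * K + 7) + (k0 + 1) + 15) * (n * n ^ (3 * k0 + 4))"
    unfolding pass_cost_def betti_cost_def add_mult_distrib[symmetric] by (simp only: mult_ac)
  also have "n * n ^ (3 * k0 + 4) = n ^ (3 * k0 + 5)"
    by (metis power_Suc add_Suc_right Suc_numeral semiring_norm(5))
  finally show "enat (total_ops k0 s)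
      \<le> enat (4 * ((k0 + 1) * (k0 + 2 * K + 7) + (k0 + 1) + 15) * n ^ (3 * k0 + 5))"
    by (simp only: enat_ord_simps)
qed

end

section \<open>Balls in the torus\<close>

text \<open>These index the fundamental domain and its neighbouring translates.\<close>

definition shift_vectors :: "(int ^ 'd) set" where
  "shift_vectors = {z. \<forall>i. z $ i \<in> {-1, 0, 1}}"

lemma finite_shift_vectors: "finite (shift_vectors :: (int ^ 'd) set)"
  and card_shift_vectors: "card (shift_vectors :: (int ^ 'd) set) \<le> 3 ^ CARD('d)"
proof -
  let ?E = "\<Pi>\<^sub>E i\<in>(UNIV :: 'd set). {-1, 0, 1 :: int}"
  have sub: "(shift_vectors :: (int ^ 'd) set) \<subseteq> vec_lambda ` ?E"
  proof
    fix z :: "int ^ 'd" assume "z \<in> shift_vectors"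
    thus "z \<in> vec_lambda ` ?E"
      by (intro image_eqI[of _ _ "vec_nth z"]) (auto simp: shift_vectors_def)
  qed
  have fin: "finite ?E" by (intro finite_PiE) auto
  show "finite (shift_vectors :: (int ^ 'd) set)"
    using sub fin by (meson finite_imageI finite_subset)
  have "card (shift_vectors :: (int ^ 'd) set) \<le> card ?E"
    using sub fin by (meson card_image_le card_mono finite_imageI order_trans)
  also have "\<dots> = 3 ^ CARD('d)" by (simp add: card_PiE numeral_3_eq_3)
  finally show "card (shift_vectors :: (int ^ 'd) set) \<le> 3 ^ CARD('d)" .
qed

text \<open>The distance is an infimum over infinitely many shifts, so a bound on it does not by
  itself yield a shift. A gap does: every shift outside \<open>shift_vectors\<close> gives norm at
  least \<open>a > r\<close>, and finitely many remain.\<close>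

lemma torus_dist_le_attained:
  fixes x y :: "real ^ 'd"
  assumes xy: "x \<in> torus_domain a" "y \<in> torus_domain a"
    and r: "0 \<le> r" "r < a" and le: "torus_dist a x y \<le> r"
  shows "\<exists>z\<in>shift_vectors. infnorm (x - y + (\<chi> i. a * of_int (z $ i))) \<le> r"
proof (rule ccontr)
  define f where "f = (\<lambda>z :: int ^ 'd. infnorm (x - y + (\<chi> i. a * of_int (z $ i))))"
  assume "\<not> ?thesis"
  hence gt: "f z > r" if "z \<in> shift_vectors" for z using that by (auto simp: f_def not_le)
  \<comment> \<open>The element \<open>a\<close> accounts for all shifts outside the finite set, so
    \<open>m\<close> is a lower bound for \<open>f\<close> strictly above \<open>r\<close>.\<close>
  define m where "m = Min (insert a (f ` shift_vectors))"
  have "m > r"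
    unfolding m_def using finite_shift_vectors gt r by (subst Min_gr_iff) auto
  have "m \<le> f z" for z
  proof (cases "z \<in> shift_vectors")
    case True
    thus ?thesis unfolding m_def using finite_shift_vectors by (intro Min_le) auto
  next
    case False
    then obtain i where "z $ i \<notin> {-1, 0, 1}"
      by (auto simp: shift_vectors_def)
    hence i: "z $ i \<ge> 2 \<or> z $ i \<le> - 2" by auto
    \<comment> \<open>Coordinates in the domain differ by less than \<open>a\<close>, while the
      shift moves coordinate \<open>i\<close> by at least \<open>2 * a\<close>.\<close>
    have b: "\<bar>x $ i - y $ i\<bar> < a"
      using xy by (auto simp: torus_domain_def abs_less_iff dest!: spec[of _ i])
    have "\<bar>a * of_int (z $ i)\<bar> = a * \<bar>of_int (z $ i)\<bar>"
      using r by (simp add: abs_mult)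
    also have "\<dots> \<ge> a * 2" using i r by (intro mult_left_mono) auto
    finally have "a \<le> \<bar>x $ i - y $ i + a * of_int (z $ i)\<bar>" using b by linarith
    also have "\<dots> \<le> f z"
      using component_le_infnorm_cart[of "x - y + (\<chi> i. a * of_int (z $ i))" i]
      by (simp add: f_def)
    finally have "a \<le> f z" .
    moreover have "m \<le> a" unfolding m_def using finite_shift_vectors by (intro Min_le) auto
    ultimately show ?thesis by linarith
  qed
  hence "m \<le> torus_dist a x y"
    unfolding torus_dist_def f_def by (intro cINF_greatest) auto
  with \<open>m > r\<close> le show False by linarith
qed

section \<open>Measures of cubes, of the fundamental domain and of balls\<close>

lemma emeasure_cube:
  fixes c :: "real ^ 'd"
  assumes "0 \<le> r"
  shows "emeasure lborel (cbox (c - (\<chi> i. r)) (c + (\<chi> i. r))) = ennreal ((2 * r) ^ CARD('d))"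
    "emeasure lborel (box (c - (\<chi> i. r)) (c + (\<chi> i. r))) = ennreal ((2 * r) ^ CARD('d))"
proof -
  have b: "(\<chi> i. r) \<bullet> b = r" if "b \<in> Basis" for b :: "real ^ 'd"
    using that by (auto simp: Basis_vec_def inner_axis)
  have "(\<Prod>b\<in>Basis. (c + (\<chi> i. r) - (c - (\<chi> i. r))) \<bullet> b) = (2 * r) ^ CARD('d)"
    by (subst prod.cong[OF refl, of _ _ "\<lambda>_. 2 * r"]) (simp_all only: inner_diff_left inner_add_left b, simp_all)
  thus "emeasure lborel (cbox (c - (\<chi> i. r)) (c + (\<chi> i. r))) = ennreal ((2 * r) ^ CARD('d))"
    "emeasure lborel (box (c - (\<chi> i. r)) (c + (\<chi> i. r))) = ennreal ((2 * r) ^ CARD('d))"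
    using assms by (simp_all add: inner_diff_left inner_add_left b)
qed

lemma torus_domain_measurable [measurable]: "torus_domain a \<in> sets borel"
  unfolding torus_domain_def by measurable

text \<open>The half-open cube lies between the open and the closed cube of side \<open>a\<close>,
  which have equal measure.\<close>

lemma emeasure_torus_domain:
  assumes "0 \<le> a"
  shows "emeasure lborel (torus_domain a :: (real ^ 'd) set) = ennreal (a ^ CARD('d))"
proof (rule antisym)
  let ?c = "(\<chi> i. a / 2) :: real ^ 'd"
  let ?l = "?c - (\<chi> i. a / 2)" and ?u = "?c + (\<chi> i. a / 2)"
  have "torus_domain a \<subseteq> cbox ?l ?u" "box ?l ?u \<subseteq> torus_domain a"
    by (auto simp: torus_domain_def mem_box_cart less_imp_le)
  hence "emeasure lborel (torus_domain a :: (real ^ 'd) set) \<le> emeasure lborel (cbox ?l ?u)"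
    "emeasure lborel (box ?l ?u) \<le> emeasure lborel (torus_domain a :: (real ^ 'd) set)"
    by (auto intro!: emeasure_mono)
  thus "emeasure lborel (torus_domain a :: (real ^ 'd) set) \<le> ennreal (a ^ CARD('d))"
    "ennreal (a ^ CARD('d)) \<le> emeasure lborel (torus_domain a :: (real ^ 'd) set)"
    using emeasure_cube[of "a / 2" ?c] assms by simp_all
qed

text \<open>The distance is an infimum over the countable lattice.\<close>

lemma torus_dist_measurable [measurable]:
  fixes f g :: "'w \<Rightarrow> real ^ 'd"
  assumes [measurable]: "f \<in> borel_measurable M" "g \<in> borel_measurable M"
  shows "(\<lambda>w. torus_dist a (f w) (g w)) \<in> borel_measurable M"
proof -
  have [measurable]: "(infnorm :: real ^ 'd \<Rightarrow> real) \<in> borel_measurable borel"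
    by (intro borel_measurable_continuous_onI continuous_on_infnorm continuous_on_id)
  show ?thesis
    unfolding torus_dist_def by measurable
qed

text \<open>At most \<open>3 ^ CARD('d)\<close> cubes of volume \<open>(2 * r) ^ CARD('d)\<close>,
  relative to the volume \<open>a ^ CARD('d)\<close> of the domain, give the factor
  \<open>6 ^ CARD('d)\<close>.\<close>

lemma emeasure_torus_ball:
  fixes x :: "real ^ 'd"
  assumes x: "x \<in> torus_domain a" and r: "0 \<le> r" "r < a"
  shows "emeasure (uniform_measure lborel (torus_domain a)) {y. torus_dist a x y \<le> r}
    \<le> ennreal (6 ^ CARD('d) * (r / a) ^ CARD('d))"
proof -
  let ?T = "torus_domain a :: (real ^ 'd) set"
  let ?c = "\<lambda>z :: int ^ 'd. x + (\<chi> i. a * of_int (z $ i))"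
  let ?C = "\<lambda>z. cbox (?c z - (\<chi> i. r)) (?c z + (\<chi> i. r))"
  have "?T \<inter> {y. torus_dist a x y \<le> r} \<subseteq> (\<Union>z\<in>shift_vectors. ?C z)"
  proof
    fix y assume "y \<in> ?T \<inter> {y. torus_dist a x y \<le> r}"
    then obtain z where z: "z \<in> shift_vectors" "infnorm (x - y + (\<chi> i. a * of_int (z $ i))) \<le> r"
      using torus_dist_le_attained[OF x _ r, of y] by blast
    have "\<bar>x $ i - y $ i + a * of_int (z $ i)\<bar> \<le> r" for i
      using component_le_infnorm_cart[of "x - y + (\<chi> i. a * of_int (z $ i))" i] z(2) by simp
    hence "y \<in> ?C z" by (force simp: mem_box_cart abs_le_iff algebra_simps)
    thus "y \<in> (\<Union>z\<in>shift_vectors. ?C z)" using z(1) by blast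
  qed
  hence "emeasure lborel (?T \<inter> {y. torus_dist a x y \<le> r}) \<le> emeasure lborel (\<Union>z\<in>shift_vectors. ?C z)"
    using finite_shift_vectors by (intro emeasure_mono sets.finite_UN) auto
  also have "\<dots> \<le> (\<Sum>z\<in>shift_vectors. emeasure lborel (?C z))"
    using finite_shift_vectors by (intro emeasure_subadditive_finite) auto
  also have "\<dots> = (\<Sum>z\<in>(shift_vectors :: (int ^ 'd) set). ennreal ((2 * r) ^ CARD('d)))"
    by (intro sum.cong refl emeasure_cube r)
  also have "\<dots> = ennreal (card (shift_vectors :: (int ^ 'd) set) * (2 * r) ^ CARD('d))"
    using r by (simp add: ennreal_mult' ennreal_of_nat_eq_real_of_nat)
  also have "\<dots> \<le> ennreal (3 ^ CARD('d) * (2 * r) ^ CARD('d))"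
    using r card_shift_vectors[where 'd='d] of_nat_mono[OF card_shift_vectors[where 'd='d], where 'a=real]
    by (intro ennreal_leI mult_right_mono) auto
  also have "3 ^ CARD('d) * (2 * r) ^ CARD('d) = (6 * r) ^ CARD('d)"
    by (simp only: power_mult_distrib[symmetric] mult.assoc[symmetric]) simp
  finally have le: "emeasure lborel (?T \<inter> {y. torus_dist a x y \<le> r}) \<le> ennreal ((6 * r) ^ CARD('d))" .
  have "emeasure (uniform_measure lborel ?T) {y. torus_dist a x y \<le> r}
      = emeasure lborel (?T \<inter> {y. torus_dist a x y \<le> r}) / emeasure lborel ?T"
    by (subst emeasure_uniform_measure) simp_all
  also have "\<dots> \<le> ennreal ((6 * r) ^ CARD('d)) / ennreal (a ^ CARD('d))"
    unfolding emeasure_torus_domain[OF less_imp_le[OF order_le_less_trans[OF r]]]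
    by (rule divide_right_mono_ennreal[OF le])
  also have "\<dots> = ennreal (6 ^ CARD('d) * (r / a) ^ CARD('d))"
    using r by (simp add: divide_ennreal power_mult_distrib power_divide)
  finally show ?thesis .
qed

section \<open>The number of simplices\<close>

text \<open>Given the centre \<open>X i\<close>, the other points are independent and each is
  related to it with probability at most \<open>p\<close>; Fubini turns this into a product. The
  bound \<open>nbhd\<close> is asked only almost everywhere, since balls are estimated for centres
  in the fundamental domain.\<close>

lemma (in prob_space) prob_star_le:
  fixes X :: "'i \<Rightarrow> 'a \<Rightarrow> 'b"
  assumes indep: "indep_vars (\<lambda>_. N) X (insert i J)" and J: "finite J" "i \<notin> J"
    and law: "\<And>j. j \<in> insert i J \<Longrightarrow> distr M N (X j) = \<mu>"
    and R [measurable]: "Measurable.pred (N \<Otimes>\<^sub>M N) (\<lambda>u. R (fst u) (snd u))"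
    and nbhd: "AE x in \<mu>. emeasure \<mu> {y \<in> space N. R x y} \<le> ennreal p" and p: "0 \<le> p"
  shows "prob {\<omega> \<in> space M. \<forall>j\<in>J. R (X i \<omega>) (X j \<omega>)} \<le> p ^ card J"
proof -
  let ?I = "insert i J"
  have X [measurable]: "random_variable N (X j)" if "j \<in> ?I" for j
    using indep that by (auto simp: indep_vars_def)
  have sets_\<mu> [measurable_cong]: "sets \<mu> = sets N" using law[of i] by auto
  have space_\<mu>: "space \<mu> = space N" by (rule sets_eq_imp_space_eq[OF sets_\<mu>])
  interpret \<mu>: prob_space \<mu> using prob_space_distr[OF X[of i]] law[of i] by simp
  interpret P: product_prob_space "\<lambda>_ :: 'i. \<mu>" ..
  let ?P = "\<lambda>I :: 'i set. Pi\<^sub>M I (\<lambda>_. \<mu>)"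
  let ?E = "{x \<in> space (?P ?I). \<forall>j\<in>J. R (x i) (x j)}"
  have E [measurable]: "?E \<in> sets (?P ?I)"
  proof -
    have "{x \<in> space (?P ?I). R (x i) (x j)} \<in> sets (?P ?I)" if "j \<in> J" for j
    proof -
      have [measurable]: "(\<lambda>x. (x i, x j)) \<in> ?P ?I \<rightarrow>\<^sub>M N \<Otimes>\<^sub>M N"
        using that by (intro measurable_Pair) (auto intro!: measurable_component_singleton simp: measurable_cong_sets[OF refl sets_\<mu>[symmetric]])
      have "Measurable.pred (?P ?I) (\<lambda>x. R (fst (x i, x j)) (snd (x i, x j)))"
        by measurable
      thus ?thesis by (simp add: pred_def)
    qed
    thus ?thesis using J by (intro sets.sets_Collect_finite_All) auto
  qed
  \<comment> \<open>Independence enters here: the joint law is a product measure.\<close>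
  have joint: "distr M (Pi\<^sub>M ?I (\<lambda>_. N)) (\<lambda>\<omega>. \<lambda>j\<in>?I. X j \<omega>) = ?P ?I"
  proof -
    have "distr M (Pi\<^sub>M ?I (\<lambda>_. N)) (\<lambda>\<omega>. \<lambda>j\<in>?I. X j \<omega>) = Pi\<^sub>M ?I (\<lambda>j. distr M N (X j))"
      using indep_vars_iff_distr_eq_PiM'[of ?I X "\<lambda>_. N"] indep X by auto
    also have "\<dots> = ?P ?I" by (intro PiM_cong refl law)
    finally show ?thesis .
  qed
  have sets_P: "sets (Pi\<^sub>M ?I (\<lambda>_. N)) = sets (?P ?I)"
    by (intro sets_PiM_cong refl sets_\<mu>[symmetric])
  have "emeasure M {\<omega> \<in> space M. \<forall>j\<in>J. R (X i \<omega>) (X j \<omega>)}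
      = emeasure (distr M (Pi\<^sub>M ?I (\<lambda>_. N)) (\<lambda>\<omega>. \<lambda>j\<in>?I. X j \<omega>)) ?E"
  proof (subst emeasure_distr)
    show "(\<lambda>\<omega>. \<lambda>j\<in>?I. X j \<omega>) \<in> M \<rightarrow>\<^sub>M Pi\<^sub>M ?I (\<lambda>_. N)"
      by (intro measurable_restrict X)
    show "?E \<in> sets (Pi\<^sub>M ?I (\<lambda>_. N))" using E sets_P by simp
    show "emeasure M {\<omega> \<in> space M. \<forall>j\<in>J. R (X i \<omega>) (X j \<omega>)}
        = emeasure M ((\<lambda>\<omega>. \<lambda>j\<in>?I. X j \<omega>) -` ?E \<inter> space M)"
      using measurable_space[OF X]
      by (intro arg_cong[where f = "emeasure M"]) (auto simp: space_PiM space_\<mu>)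
  qed
  also have "\<dots> = emeasure (?P ?I) ?E" by (simp only: joint)
  also have "\<dots> = (\<integral>\<^sup>+x. indicator ?E x \<partial>?P ?I)" by simp
  also have "\<dots> = (\<integral>\<^sup>+y. (\<integral>\<^sup>+x. indicator ?E (x(i := y)) \<partial>?P J) \<partial>\<mu>)"
    using J by (intro P.product_nn_integral_insert_rev) simp_all
  also have "\<dots> \<le> (\<integral>\<^sup>+y. ennreal (p ^ card J) \<partial>\<mu>)"
  proof (rule nn_integral_mono_AE)
    show "AE y in \<mu>. (\<integral>\<^sup>+x. indicator ?E (x(i := y)) \<partial>?P J) \<le> ennreal (p ^ card J)"
      using nbhd AE_space
    proof eventually_elim
      case (elim y)
      let ?B = "{z \<in> space N. R y z}"
      have B: "?B \<in> sets \<mu>"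
      proof -
        have [measurable]: "y \<in> space N" using elim(2) by (simp add: space_\<mu>)
        have "Measurable.pred N (\<lambda>z. R (fst (y, z)) (snd (y, z)))" by measurable
        thus ?thesis by (simp add: pred_def sets_\<mu>)
      qed
      \<comment> \<open>For a fixed centre \<open>y\<close> the section of \<open>?E\<close> is a
        product of copies of \<open>?B\<close>.\<close>
      have "(\<integral>\<^sup>+x. indicator ?E (x(i := y)) \<partial>?P J) = (\<integral>\<^sup>+x. indicator (PiE J (\<lambda>_. ?B)) x \<partial>?P J)"
        using J elim(2)
        by (intro nn_integral_cong)
          (auto simp: indicator_def space_PiM space_\<mu> PiE_def extensional_def Pi_def)
      also have "\<dots> = emeasure (?P J) (PiE J (\<lambda>_. ?B))"
        using B J by (intro nn_integral_indicator sets_PiM_I_finite) auto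
      also have "\<dots> = (\<Prod>j\<in>J. emeasure \<mu> ?B)"
        using B J by (intro P.emeasure_PiM) auto
      also have "\<dots> \<le> (\<Prod>j\<in>J. ennreal p)"
        using elim(1) by (intro prod_mono_ennreal)
      also have "\<dots> = ennreal (p ^ card J)" using p by (simp add: ennreal_power)
      finally show ?case .
    qed
  qed
  also have "\<dots> = ennreal (p ^ card J)" by (simp add: \<mu>.emeasure_space_1)
  finally show ?thesis
    using p by (simp add: emeasure_eq_measure)
qed

text \<open>The binomial theorem by subsets: expand the product of \<open>p + 1\<close> over
  \<open>A\<close>, with \<open>p\<close> chosen on \<open>J\<close>.\<close>

lemma sum_Pow_power_card:
  fixes p :: "'a :: comm_semiring_1"
  assumes "finite A"
  shows "(\<Sum>J\<in>Pow A. p ^ card J) = (1 + p) ^ card A"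
  using prod_add[OF assms, of "\<lambda>_. p" "\<lambda>_. 1"] by (simp add: add.commute)

text \<open>Mark an element \<open>i\<close> of each set and write the set as
  \<open>insert i J\<close>. Summing over all pairs counts every nonempty set at least once, with
  \<open>card J\<close> one less than its size.\<close>

lemma sum_nonempty_power_card_le:
  fixes p :: real
  assumes "0 \<le> p"
  shows "(\<Sum>\<sigma>\<in>Pow {..<n} - {{}}. p ^ (card \<sigma> - 1)) \<le> real n * (1 + p) ^ n"
proof -
  let ?T = "SIGMA i:{..<n}. Pow ({..<n} - {i})"
  have fin: "finite ?T" by (intro finite_SigmaI) auto
  have "(\<Sum>\<sigma>\<in>Pow {..<n} - {{}}. p ^ (card \<sigma> - 1)) \<le> (\<Sum>(i, J)\<in>?T. p ^ card J)"
  proof (rule sum_le_included[where i = "\<lambda>(i, J). insert i J"])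
    show "\<forall>\<sigma>\<in>Pow {..<n} - {{}}. \<exists>u\<in>?T. (case u of (i, J) \<Rightarrow> insert i J) = \<sigma> \<and>
        p ^ (card \<sigma> - 1) \<le> (case u of (i, J) \<Rightarrow> p ^ card J)"
    proof
      fix \<sigma> assume \<sigma>: "\<sigma> \<in> Pow {..<n} - {{}}"
      then obtain i where i: "i \<in> \<sigma>" by blast
      have "finite \<sigma>" using \<sigma> finite_subset by auto
      thus "\<exists>u\<in>?T. (case u of (i, J) \<Rightarrow> insert i J) = \<sigma> \<and>
          p ^ (card \<sigma> - 1) \<le> (case u of (i, J) \<Rightarrow> p ^ card J)"
        using i \<sigma> by (intro bexI[of _ "(i, \<sigma> - {i})"]) (auto simp: insert_absorb)
    qed
  qed (use assms fin in auto)
  also have "\<dots> = (\<Sum>i<n. \<Sum>J\<in>Pow ({..<n} - {i}). p ^ card J)"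
    by (subst sum.Sigma) auto
  also have "\<dots> = (\<Sum>i<n. (1 + p) ^ (n - 1))"
    by (intro sum.cong refl) (simp add: sum_Pow_power_card)
  also have "\<dots> \<le> real n * (1 + p) ^ n"
    using assms by (auto intro!: mult_left_mono power_increasing)
  finally show ?thesis .
qed

text \<open>The size is a sum of indicators with mean at most \<open>n * (1 + p) ^ n\<close>;
  against the threshold n^2, Markov's inequality leaves a factor \<open>1 / n\<close>.\<close>

lemma (in prob_space) prob_card_complex_gt:
  assumes n: "n > 0" and p: "0 \<le> p" and S: "\<And>\<omega>. S \<omega> \<subseteq> Pow {..<n} - {{}}"
    and meas: "\<And>\<sigma>. \<sigma> \<in> Pow {..<n} - {{}} \<Longrightarrow> {\<omega> \<in> space M. \<sigma> \<in> S \<omega>} \<in> events"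
    and prob: "\<And>\<sigma>. \<sigma> \<in> Pow {..<n} - {{}} \<Longrightarrow> prob {\<omega> \<in> space M. \<sigma> \<in> S \<omega>} \<le> p ^ (card \<sigma> - 1)"
  shows "prob {\<omega> \<in> space M. real (card (S \<omega>)) \<ge> (real n)\<^sup>2} \<le> (1 + p) ^ n / n"
proof -
  let ?F = "Pow {..<n} - {{}}"
  let ?N = "\<lambda>\<omega>. \<Sum>\<sigma>\<in>?F. indicator {\<omega> \<in> space M. \<sigma> \<in> S \<omega>} \<omega> :: real"
  have N: "?N \<omega> = card (S \<omega>)" if "\<omega> \<in> space M" for \<omega>
  proof -
    have "?N \<omega> = (\<Sum>\<sigma>\<in>?F. indicator (S \<omega>) \<sigma>)"
      using that by (intro sum.cong) (auto simp: indicator_def)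
    also have "\<dots> = card (S \<omega>)"
      using S[of \<omega>] by (simp add: indicator_def sum.If_cases Int_absorb1)
    finally show ?thesis .
  qed
  have ind: "integrable M (indicator {\<omega> \<in> space M. \<sigma> \<in> S \<omega>} :: 'a \<Rightarrow> real)"
    if "\<sigma> \<in> ?F" for \<sigma>
    using meas[OF that] by (intro integrable_real_indicator) (auto simp: emeasure_eq_measure)
  have "expectation ?N = (\<Sum>\<sigma>\<in>?F. prob {\<omega> \<in> space M. \<sigma> \<in> S \<omega>})"
    using ind meas by (subst Bochner_Integration.integral_sum) (auto intro!: sum.cong)
  also have "\<dots> \<le> (\<Sum>\<sigma>\<in>?F. p ^ (card \<sigma> - 1))" by (intro sum_mono prob)
  also have "\<dots> \<le> real n * (1 + p) ^ n" by (rule sum_nonempty_power_card_le[OF p])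
  finally have E: "expectation ?N \<le> real n * (1 + p) ^ n" .
  have "prob {\<omega> \<in> space M. ?N \<omega> \<ge> (real n)\<^sup>2} \<le> expectation ?N / (real n)\<^sup>2"
    using n ind 
    by (intro integral_Markov_inequality_measure[where A = "space M"] Bochner_Integration.integrable_sum)
      (auto intro!: sum_nonneg)
  also have "\<dots> \<le> real n * (1 + p) ^ n / (real n)\<^sup>2"
    using E by (intro divide_right_mono) auto
  also have "\<dots> = (1 + p) ^ n / n" using n by (simp add: power2_eq_square)
  also have "{\<omega> \<in> space M. ?N \<omega> \<ge> (real n)\<^sup>2} = {\<omega> \<in> space M. real (card (S \<omega>)) \<ge> (real n)\<^sup>2}"
    using N by auto
  finally show ?thesis .
qed

text \<open>A random subset of a finite set takes finitely many values, each on a measurable event,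
  so any property of it is measurable, including a bound on the complexity.\<close>

lemma sets_Collect_finite_set_valued:
  assumes F: "finite F" "\<And>\<omega>. S \<omega> \<subseteq> F"
    and meas: "\<And>\<sigma>. \<sigma> \<in> F \<Longrightarrow> {\<omega> \<in> space M. \<sigma> \<in> S \<omega>} \<in> sets M"
  shows "{\<omega> \<in> space M. P (S \<omega>)} \<in> sets M"
proof -
  have "{\<omega> \<in> space M. P (S \<omega>)} = (\<Union>T\<in>{T \<in> Pow F. P T}. {\<omega> \<in> space M. \<forall>\<sigma>\<in>F. \<sigma> \<in> S \<omega> \<longleftrightarrow> \<sigma> \<in> T})"
    (is "?A = ?B")
  proof
    show "?A \<subseteq> ?B" using F(2) by auto
    show "?B \<subseteq> ?A"
    proof
      fix \<omega> assume "\<omega> \<in> ?B"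
      then obtain T where T: "T \<subseteq> F" "P T" "\<omega> \<in> space M" "\<forall>\<sigma>\<in>F. \<sigma> \<in> S \<omega> \<longleftrightarrow> \<sigma> \<in> T" by auto
      hence "S \<omega> = T" using F(2)[of \<omega>] by blast
      thus "\<omega> \<in> ?A" using T by auto
    qed
  qed
  moreover have "{\<omega> \<in> space M. \<forall>\<sigma>\<in>F. \<sigma> \<in> S \<omega> \<longleftrightarrow> \<sigma> \<in> T} \<in> sets M" for T
    using meas F(1) by (intro sets.sets_Collect_finite_All sets.sets_Collect) auto
  ultimately show ?thesis using F(1) by auto
qed

section \<open>Simplices of the random Vietoris-Rips complex\<close>

lemma rips_complex_subset: "rips_complex a r x n \<subseteq> Pow {..<n} - {{}}"
  by (auto simp: rips_complex_def)

lemma binomial_point_process_measurable: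
  assumes "binomial_point_process M X n a" "i < n"
  shows "X i \<in> borel_measurable M"
proof -
  interpret prob_space M using assms by (simp add: binomial_point_process_def)
  show ?thesis using assms by (auto simp: binomial_point_process_def indep_vars_def)
qed

lemma sets_simplex_in_rips_complex:
  fixes X :: "nat \<Rightarrow> 'w \<Rightarrow> real ^ 'd"
  assumes X: "binomial_point_process M X n a" and \<sigma>: "\<sigma> \<in> Pow {..<n} - {{}}"
  shows "{\<omega> \<in> space M. \<sigma> \<in> rips_complex a r (\<lambda>i. X i \<omega>) n} \<in> sets M"
proof -
  have "finite \<sigma>" using \<sigma> finite_subset by auto
  have X' [measurable]: "X i \<in> borel_measurable M" if "i \<in> \<sigma>" for i
    using \<sigma> that by (intro binomial_point_process_measurable[OF X]) auto
  have "{\<omega> \<in> space M. \<forall>i\<in>\<sigma>. \<forall>j\<in>\<sigma>. i \<noteq> j \<longrightarrow> torus_dist a (X i \<omega>) (X j \<omega>) \<le> r} \<in> sets M"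
    using \<open>finite \<sigma>\<close> by (intro sets.sets_Collect_finite_All sets.sets_Collect) measurable
  thus ?thesis using \<sigma> by (simp add: rips_complex_def pairwise_def)
qed

text \<open>Of the pairwise conditions only those involving one chosen vertex \<open>i\<close> are
  kept. This star event has \<open>card \<sigma> - 1\<close> constraints, whence the
  exponent.\<close>

lemma prob_simplex_in_rips_complex:
  fixes X :: "nat \<Rightarrow> 'w \<Rightarrow> real ^ 'd"
  assumes X: "binomial_point_process M X n a" and \<sigma>: "\<sigma> \<in> Pow {..<n} - {{}}"
    and r: "0 \<le> r" "r < a"
  shows "measure M {\<omega> \<in> space M. \<sigma> \<in> rips_complex a r (\<lambda>i. X i \<omega>) n}
    \<le> (6 ^ CARD('d) * (r / a) ^ CARD('d)) ^ (card \<sigma> - 1)"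
proof -
  interpret prob_space M using X by (simp add: binomial_point_process_def)
  from \<sigma> obtain i where i: "i \<in> \<sigma>" by blast
  have fin: "finite \<sigma>" using \<sigma> finite_subset by auto
  let ?J = "\<sigma> - {i}" and ?\<mu> = "uniform_measure lborel (torus_domain a :: (real ^ 'd) set)"
  have ins: "insert i ?J = \<sigma>" using i by auto
  have X' [measurable]: "X i \<in> borel_measurable M" if "i \<in> \<sigma>" for i
    using \<sigma> that by (intro binomial_point_process_measurable[OF X]) auto
  have "prob {\<omega> \<in> space M. \<sigma> \<in> rips_complex a r (\<lambda>i. X i \<omega>) n}
      \<le> prob {\<omega> \<in> space M. \<forall>j\<in>?J. torus_dist a (X i \<omega>) (X j \<omega>) \<le> r}"
  proof (rule finite_measure_mono)
    show "{\<omega> \<in> space M. \<forall>j\<in>?J. torus_dist a (X i \<omega>) (X j \<omega>) \<le> r} \<in> events"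
      using fin i by (intro sets.sets_Collect_finite_All) measurable
  qed (use i in \<open>auto simp: rips_complex_def pairwise_def\<close>)
  also have "\<dots> \<le> (6 ^ CARD('d) * (r / a) ^ CARD('d)) ^ card ?J"
  proof (rule prob_star_le[where N = borel and \<mu> = ?\<mu>])
    show "indep_vars (\<lambda>_. borel) X (insert i ?J)"
      using X \<sigma> indep_vars_subset[of "\<lambda>_. borel" X "{..<n}" \<sigma>]
      unfolding ins by (simp add: binomial_point_process_def)
    show "distr M borel (X j) = ?\<mu>" if "j \<in> insert i ?J" for j
      using X \<sigma> that unfolding ins by (auto simp: binomial_point_process_def)
    show "AE x in ?\<mu>. emeasure ?\<mu> {y \<in> space borel. torus_dist a x y \<le> r}
        \<le> ennreal (6 ^ CARD('d) * (r / a) ^ CARD('d))"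
    proof (intro AE_uniform_measureI AE_I2 impI)
      fix x :: "real ^ 'd" assume "x \<in> torus_domain a"
      from emeasure_torus_ball[OF this r]
      show "emeasure ?\<mu> {y \<in> space borel. torus_dist a x y \<le> r}
          \<le> ennreal (6 ^ CARD('d) * (r / a) ^ CARD('d))"
        by (simp only: space_borel UNIV_I simp_thms)
    qed simp
  qed (use fin r in simp_all)
  also have "card ?J = card \<sigma> - 1" using i fin by simp
  finally show ?thesis .
qed

section \<open>The reduction algorithm in the subcritical regime\<close>

theorem theorem12:
  fixes k0 :: nat
    and a r \<theta> :: "nat \<Rightarrow> real"
    and M :: "nat \<Rightarrow> 'w measure"
    and X :: "nat \<Rightarrow> nat \<Rightarrow> 'w \<Rightarrow> real ^ 'd"
    and rk :: "nat \<Rightarrow> nat \<Rightarrow> nat"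
  assumes "\<And>n. a n > 0" and "\<And>n. r n \<ge> 0"
    and "\<And>n. binomial_point_process (M n) (X n) n (a n)"
    and "\<And>n. \<theta> n = (r n / a n) ^ CARD('d)"
    and "\<And>n. \<theta> n \<le> (1 / 2) ^ CARD('d)"
    and subcritical: "\<theta> \<in> o(\<lambda>n. 1 / real n)"
    and rank_cost: "\<exists>K. \<forall>p q. rk p q \<le> K * (p * q * min p q + 1)"
  shows "\<exists>C :: nat. asymptotically_almost_surely M (\<lambda>n \<omega>.
           \<forall>L. distinct L \<and> set L \<subseteq> {..<n} \<longrightarrow>
             complexity TYPE('f::field) rk k0 (rips_complex (a n) (r n) (\<lambda>i. X n i \<omega>) n) L
               \<le> enat (C * n ^ (3 * k0 + 7)))"
proof -
  obtain K where K: "\<And>p q. rk p q \<le> K * (p * q * min p q + 1)" using rank_cost by blast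
  define C where "C = 4 * ((k0 + 1) * (k0 + 2 * K + 7) + (k0 + 1) + 15)"
  define S where "S = (\<lambda>n \<omega>. rips_complex (a n) (r n) (\<lambda>i. X n i \<omega>) n)"
  \<comment> \<open>A property of the complex alone, hence measurable; the list is quantified inside
    the event and may depend on the outcome.\<close>
  define P where "P = (\<lambda>n T. \<forall>L. distinct L \<and> set L \<subseteq> {..<n} \<longrightarrow>
    complexity TYPE('f) rk k0 T L \<le> enat (C * n ^ (3 * k0 + 7)))"
  define p where "p = (\<lambda>n. 6 ^ CARD('d) * \<theta> n)"
  have \<theta>0: "\<theta> n \<ge> 0" for n using assms(1,2,4)[of n] by simp
  \<comment> \<open>The bound on \<theta> gives \<open>r n \<le> a n / 2\<close>, so the ball
    estimate applies.\<close>
  have ra: "r n < a n" for n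
  proof -
    have "(r n / a n) ^ CARD('d) \<le> (1 / 2) ^ CARD('d)" using assms(4,5)[of n] by simp
    hence "r n / a n \<le> 1 / 2"
      using assms(1,2)[of n] by (subst (asm) power_mono_iff) (simp_all add: less_imp_le)
    thus ?thesis using assms(1)[of n] by (simp add: field_simps)
  qed
  \<comment> \<open>With at most n^2 simplices even the exponent \<open>3 * k0 + 5\<close> suffices;
    \<open>C\<close> depends only on \<open>k0\<close> and \<open>K\<close>.\<close>
  have small: "P n T" if "n > 0" "T \<subseteq> Pow {..<n}" "card T \<le> n\<^sup>2" for n T
    unfolding P_def
  proof (intro allI impI, elim conjE)
    fix L assume L: "distinct L" "set L \<subseteq> {..<n}"
    have "complexity TYPE('f) rk k0 T L \<le> enat (C * n ^ (3 * k0 + 5))"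
      unfolding C_def by (rule complexity_le[OF K that L])
    also have "\<dots> \<le> enat (C * n ^ (3 * k0 + 7))"
      using that(1) by (simp add: power_increasing)
    finally show "complexity TYPE('f) rk k0 T L \<le> enat (C * n ^ (3 * k0 + 7))" .
  qed
  have bound: "1 - exp (real n * p n) / real n \<le> measure (M n) {\<omega> \<in> space (M n). P n (S n \<omega>)}"
    "measure (M n) {\<omega> \<in> space (M n). P n (S n \<omega>)} \<le> 1"
    if n: "n > 0" for n
  proof -
    interpret prob_space "M n" using assms(3)[of n] by (simp add: binomial_point_process_def)
    show "prob {\<omega> \<in> space (M n). P n (S n \<omega>)} \<le> 1" by (rule prob_le_1)
    have sub: "S n \<omega> \<subseteq> Pow {..<n} - {{}}" for \<omega>
      unfolding S_def by (rule rips_complex_subset)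
    have meas: "{\<omega> \<in> space (M n). \<sigma> \<in> S n \<omega>} \<in> events" if "\<sigma> \<in> Pow {..<n} - {{}}" for \<sigma>
      unfolding S_def by (rule sets_simplex_in_rips_complex[OF assms(3) that])
    have events: "{\<omega> \<in> space (M n). Q (S n \<omega>)} \<in> events" for Q
      by (rule sets_Collect_finite_set_valued[OF _ sub meas]) simp
    have p0: "0 \<le> p n" using \<theta>0 by (simp add: p_def)
    have "prob {\<omega> \<in> space (M n). real (card (S n \<omega>)) \<ge> (real n)\<^sup>2} \<le> (1 + p n) ^ n / n"
    proof (rule prob_card_complex_gt[OF n p0 sub meas])
      fix \<sigma> assume "\<sigma> \<in> Pow {..<n} - {{}}"
      from prob_simplex_in_rips_complex[OF assms(3) this assms(2) ra]
      show "prob {\<omega> \<in> space (M n). \<sigma> \<in> S n \<omega>} \<le> p n ^ (card \<sigma> - 1)"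
        by (simp only: S_def p_def assms(4))
    qed
    also have "\<dots> \<le> exp (p n) ^ n / n"
      using p0 by (intro divide_right_mono power_mono exp_ge_add_one_self) auto
    also have "exp (p n) ^ n = exp (real n * p n)" by (rule exp_of_nat_mult[symmetric])
    finally have "prob {\<omega> \<in> space (M n). real (card (S n \<omega>)) \<ge> (real n)\<^sup>2} \<le> exp (real n * p n) / n" .
    moreover have "prob (space (M n) - {\<omega> \<in> space (M n). real (card (S n \<omega>)) \<ge> (real n)\<^sup>2})
        = 1 - prob {\<omega> \<in> space (M n). real (card (S n \<omega>)) \<ge> (real n)\<^sup>2}"
      by (rule prob_compl[OF events])
    moreover have "prob (space (M n) - {\<omega> \<in> space (M n). real (card (S n \<omega>)) \<ge> (real n)\<^sup>2})
        \<le> prob {\<omega> \<in> space (M n). P n (S n \<omega>)}"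
    proof (intro finite_measure_mono events subsetI)
      fix \<omega> assume \<omega>: "\<omega> \<in> space (M n) - {\<omega> \<in> space (M n). real (card (S n \<omega>)) \<ge> (real n)\<^sup>2}"
      hence "real (card (S n \<omega>)) < real (n\<^sup>2)" by auto
      hence "card (S n \<omega>) \<le> n\<^sup>2" by linarith
      thus "\<omega> \<in> {\<omega> \<in> space (M n). P n (S n \<omega>)}" using \<omega> sub small[OF n] by blast
    qed
    ultimately show "1 - exp (real n * p n) / n \<le> prob {\<omega> \<in> space (M n). P n (S n \<omega>)}" by linarith
  qed
  \<comment> \<open>Subcriticality says that \<open>n * \<theta> n\<close> tends to 0, so the
    exponential tends to 1 and the error \<open>exp (n * p n) / n\<close> vanishes.\<close>
  have "(\<lambda>n. \<theta> n / (1 / real n)) \<longlonglongrightarrow> 0" by (rule smalloD_tendsto[OF subcritical])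
  hence "(\<lambda>n. 6 ^ CARD('d) * (\<theta> n / (1 / real n))) \<longlonglongrightarrow> 6 ^ CARD('d) * 0"
    by (intro tendsto_intros)
  hence "(\<lambda>n. real n * p n) \<longlonglongrightarrow> 0" by (simp add: p_def mult_ac)
  hence "(\<lambda>n. 1 - exp (real n * p n) * inverse (real n)) \<longlonglongrightarrow> 1 - exp 0 * 0"
    by (intro tendsto_intros lim_inverse_n)
  hence lim: "(\<lambda>n. 1 - exp (real n * p n) / real n) \<longlonglongrightarrow> 1"
    by (simp add: divide_inverse)
  have "(\<lambda>n. measure (M n) {\<omega> \<in> space (M n). P n (S n \<omega>)}) \<longlonglongrightarrow> 1"
    using bound
    by (intro tendsto_sandwich[OF _ _ lim tendsto_const]) (auto intro!: eventually_sequentiallyI[of 1])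
  hence "asymptotically_almost_surely M (\<lambda>n \<omega>. P n (S n \<omega>))"
    by (simp add: asymptotically_almost_surely_def)
  thus ?thesis unfolding P_def S_def by blast
qed

end
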